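(* Let $q>0$, $q\neq1$, let $l,\lambda\in\mathbb{R}$ with $l\neq0$, and let $z\in\mathbf D_{l,\lambda}$, $z\neq0$, $x=|z|^2$. The Mandel parameter of the coherent state $|z\rangle_{l,\lambda}$, $$Q_{l,\lambda}:=\frac{\langle N^2\rangle-\langle N\rangle^2-\langle N\rangle}{\langle N\rangle},$$ is given by $$Q_{l,\lambda}=x\left(\frac{\mathcal N_{l,\lambda}''(x)}{\mathcal N_{l,\lambda}'(x)}-\frac{\mathcal N_{l,\lambda}'(x)}{\mathcal N_{l,\lambda}(x)}\right).$$ For $x\ll1$, $$Q_{l,\lambda}=-\frac{q(1-q)}{l^2q^\lambda(1+q)}\,x+O(x^2),$$ meaning that the distribution $$\mathcal P_{l,\lambda}(n)=|\langle n|z\rangle_{l,\lambda}|^2=\frac{q^{n(n+1)/2}x^n}{(l^2q^\lambda)^n[n]_q!\,\mathcal N_{l,\lambda}(x)},\qquad n=0,1,2,\dots,$$ is sub-Poissonian.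
   Context: $\mathcal{F}$ is the Fock space with orthonormal basis $\{|n\rangle:n=0,1,2,\dots\}$, and $N|n\rangle=n|n\rangle$. $[n]_q=\frac{1-q^n}{1-q}$, $[0]_q!=1$, $[n]_q!=[n]_q[n-1]_q\cdots[1]_q$. Coherent states: for $z\in\mathbf D_{l,\lambda}=\{z\in\mathbb{C}:|z|^2<R_{l,\lambda}\}$, with $R_{l,\lambda}=\infty$ if $0<q<1$ and $R_{l,\lambda}=\frac{l^2q^\lambda}{q-1}$ if $q>1$, $$|z\rangle_{l,\lambda}=\mathcal N_{l,\lambda}(|z|^2)^{-1/2}\sum_{n=0}^\infty\frac{q^{n(n+1)/4}z^n}{\sqrt{(l^2q^\lambda)^n[n]_q!}}\,|n\rangle,\qquad \mathcal N_{l,\lambda}(x)=\sum_{n=0}^\infty\frac{q^{n(n+1)/2}x^n}{(l^2q^\lambda)^n[n]_q!}.$$ $\langle A\rangle={}_{l,\lambda}\langle z|A|z\rangle_{l,\lambda}$ denotes the expectation value of $A$ in the state $|z\rangle_{l,\lambda}$; primes denote derivatives with respect to $x$. $\mathcal P_{l,\lambda}(n)$ is the probability of finding $n$ quanta in the state $|z\rangle_{l,\lambda}$. The Mandel parameter measures the deviation from Poisson statistics; a distribution is called sub-Poissonian when its Mandel parameter is negative (variance smaller than mean).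
   Formalization: The claim that the distribution is sub-Poissonian is stated only for 0<q<1 (and x≪1), since for q>1 the leading coefficient of Q is positive and the distribution is super-Poissonian; all other claims cover every q>0, q≠1. *)

theory Defs
  imports "HOL-Probability.Probability" "HOL-Library.Landau_Symbols"
begin

text \<open>
  The Fock space is modelled as the space of square-summable sequences of complex numbers:
  a vector is identified with its sequence of coefficients in the orthonormal basis
  \<open>ket 0, ket 1, \<dots>\<close>.  Inner products are conjugate-linear in the first argument.
\<close>

definition fock_space :: "(nat \<Rightarrow> complex) set" where
  "fock_space = {\<psi>. summable (\<lambda>n. (cmod (\<psi> n))\<^sup>2)}"

definition fock_inner :: "(nat \<Rightarrow> complex) \<Rightarrow> (nat \<Rightarrow> complex) \<Rightarrow> complex" where
  "fock_inner \<phi> \<psi> = (\<Sum>n. cnj (\<phi> n) * \<psi> n)"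

definition ket :: "nat \<Rightarrow> nat \<Rightarrow> complex" where
  "ket n = (\<lambda>m. if m = n then 1 else 0)"

lemma ket_in_fock_space: "ket n \<in> fock_space"
proof -
  have "summable (\<lambda>m. (cmod (ket n m))\<^sup>2)"
    by (rule summable_finite[of "{n}"]) (auto simp: ket_def)
  then show ?thesis by (simp add: fock_space_def)
qed

lemma fock_inner_ket: "fock_inner (ket n) \<psi> = \<psi> n"
proof -
  have "(\<Sum>m. cnj (ket n m) * \<psi> m) = (\<Sum>m\<in>{n}. cnj (ket n m) * \<psi> m)"
    by (rule suminf_finite) (auto simp: ket_def)
  then show ?thesis by (simp add: fock_inner_def ket_def)
qed

text \<open>The unbounded number operator is given by its action on coefficient sequences.\<close>

definition number_op :: "(nat \<Rightarrow> complex) \<Rightarrow> (nat \<Rightarrow> complex)" where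
  "number_op \<psi> = (\<lambda>n. of_nat n * \<psi> n)"

lemma number_op_ket: "number_op (ket n) = (\<lambda>m. of_nat n * ket n m)"
  by (auto simp: number_op_def ket_def)

definition expect ::
  "((nat \<Rightarrow> complex) \<Rightarrow> (nat \<Rightarrow> complex)) \<Rightarrow> (nat \<Rightarrow> complex) \<Rightarrow> complex" where
  "expect A \<psi> = fock_inner \<psi> (A \<psi>)"

definition mandel :: "(nat \<Rightarrow> complex) \<Rightarrow> complex" where
  "mandel \<psi> = (expect (number_op \<circ> number_op) \<psi> - (expect number_op \<psi>)\<^sup>2 - expect number_op \<psi>)
                / expect number_op \<psi>"

definition q_number :: "real \<Rightarrow> nat \<Rightarrow> real" where
  "q_number q n = (1 - q ^ n) / (1 - q)"

definition q_fact :: "real \<Rightarrow> nat \<Rightarrow> real" where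
  "q_fact q n = (\<Prod>k=1..n. q_number q k)"

definition normalization :: "real \<Rightarrow> real \<Rightarrow> real \<Rightarrow> real \<Rightarrow> real" where
  "normalization q l lam x =
     (\<Sum>n. q powr (real n * (real n + 1) / 2) * x ^ n / ((l\<^sup>2 * q powr lam) ^ n * q_fact q n))"

definition radius :: "real \<Rightarrow> real \<Rightarrow> real \<Rightarrow> ereal" where
  "radius q l lam = (if q < 1 then \<infinity> else ereal (l\<^sup>2 * q powr lam / (q - 1)))"

definition coherent_domain :: "real \<Rightarrow> real \<Rightarrow> real \<Rightarrow> complex set" where
  "coherent_domain q l lam = {z. ereal ((cmod z)\<^sup>2) < radius q l lam}"

definition coherent_state :: "real \<Rightarrow> real \<Rightarrow> real \<Rightarrow> complex \<Rightarrow> (nat \<Rightarrow> complex)" where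
  "coherent_state q l lam z = (\<lambda>n.
     complex_of_real (normalization q l lam ((cmod z)\<^sup>2) powr (- 1 / 2)) *
     (complex_of_real (q powr (real n * (real n + 1) / 4)) * z ^ n
       / complex_of_real (sqrt ((l\<^sup>2 * q powr lam) ^ n * q_fact q n))))"

text \<open>
  The distribution of the number of quanta in a state, by the Born rule.  It has the intended
  probabilities only if \<open>\<psi>\<close> is a unit vector, since otherwise \<open>embed_pmf\<close> is unspecified.
\<close>

definition quanta_pmf :: "(nat \<Rightarrow> complex) \<Rightarrow> nat pmf" where
  "quanta_pmf \<psi> = embed_pmf (\<lambda>n. (cmod (fock_inner (ket n) \<psi>))\<^sup>2)"

definition mandel_pmf :: "nat pmf \<Rightarrow> real" where
  "mandel_pmf p = (measure_pmf.variance p real - measure_pmf.expectation p real)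
                    / measure_pmf.expectation p real"

text \<open>
  Finiteness of the second moment is required explicitly, because Bochner integrals of
  non-integrable functions are \<open>0\<close>.
\<close>

definition sub_poissonian :: "nat pmf \<Rightarrow> bool" where
  "sub_poissonian p \<longleftrightarrow> integrable (measure_pmf p) (\<lambda>n. (real n)\<^sup>2) \<and> mandel_pmf p < 0"

end

theory Submission imports Defs begin

text \<open>
  Up to normalization the number distribution of a coherent state is the weight
  \<open>a\<^sub>n x\<^sup>n\<close> of the power series \<open>\<N>(x)\<close>, whose radius of convergence is the radius of the domain.
  Hence \<open>\<langle>N\<rangle> = x \<N>'/\<N>\<close> and \<open>\<langle>N\<^sup>2\<rangle> = (x\<^sup>2 \<N>'' + x \<N>')/\<N>\<close>, which gives \<open>Q = x h(x)\<close> with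
  \<open>h = \<N>''/\<N>' - \<N>'/\<N>\<close>.  The function \<open>h\<close> is differentiable at \<open>0\<close> and
  \<open>h(0) = 2a\<^sub>2/a\<^sub>1 - a\<^sub>1/a\<^sub>0\<close>, so \<open>Q = h(0) x + O(x\<^sup>2)\<close>, and \<open>Q < 0\<close> near \<open>0\<close> by continuity
  of \<open>h\<close> if \<open>q < 1\<close>, because then \<open>h(0) < 0\<close>.
\<close>

subsection \<open>Power series\<close>

text \<open>\<open>diffs a\<close> lists the coefficients of the formal derivative, so the bound for
  \<open>fps_deriv\<close> transfers.\<close>

lemma conv_radius_diffs_ge:
  fixes a :: "nat \<Rightarrow> 'a :: {banach, real_normed_field}"
  shows "conv_radius a \<le> conv_radius (diffs a)"
proof -
  have "fps_nth (fps_deriv (Abs_fps a)) = diffs a"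
    by (auto simp: diffs_def)
  then show ?thesis
    using fps_conv_radius_deriv[of "Abs_fps a"] by (simp add: fps_conv_radius_def fps_nth_Abs_fps)
qed

lemma deriv_powser:
  fixes a :: "nat \<Rightarrow> 'a :: {banach, real_normed_field}"
  assumes "ereal (norm x) < conv_radius a"
  shows "deriv (\<lambda>x. \<Sum>n. a n * x ^ n) x = (\<Sum>n. diffs a n * x ^ n)"
  by (rule DERIV_imp_deriv) (rule has_field_derivative_powser[OF assms])

lemma deriv_deriv_powser:
  fixes a :: "nat \<Rightarrow> 'a :: {banach, real_normed_field}"
  assumes "ereal (norm x) < conv_radius a"
  shows "deriv (deriv (\<lambda>x. \<Sum>n. a n * x ^ n)) x = (\<Sum>n. diffs (diffs a) n * x ^ n)"
proof -
  have "x \<in> eball 0 (conv_radius a)"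
    using assms by simp
  \<comment> \<open>Differentiating again needs the formula for the first derivative on a whole
    neighbourhood of \<open>x\<close>.\<close>
  then have "\<forall>\<^sub>F y in nhds x. y \<in> eball 0 (conv_radius a)"
    by (intro eventually_nhds_in_open open_eball)
  then have "\<forall>\<^sub>F y in nhds x. deriv (\<lambda>x. \<Sum>n. a n * x ^ n) y = (\<Sum>n. diffs a n * y ^ n)"
    by eventually_elim (auto intro: deriv_powser)
  then have "deriv (deriv (\<lambda>x. \<Sum>n. a n * x ^ n)) x = deriv (\<lambda>x. \<Sum>n. diffs a n * x ^ n) x"
    by (intro deriv_cong_ev refl)
  also have "\<dots> = (\<Sum>n. diffs (diffs a) n * x ^ n)"
    using assms conv_radius_diffs_ge[of a] by (intro deriv_powser) order
  finally show ?thesis .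
qed

text \<open>The operator x d/dx multiplies the n-th term of a power series by n.\<close>

lemma powser_first_moment:
  fixes a :: "nat \<Rightarrow> 'a :: {banach, real_normed_field}"
  assumes "ereal (norm x) < conv_radius a"
  shows "(\<lambda>n. of_nat n * (a n * x ^ n)) sums (x * (\<Sum>n. diffs a n * x ^ n))"
proof -
  have "summable (\<lambda>n. diffs a n * x ^ n)"
    using assms conv_radius_diffs_ge[of a] by (intro summable_in_conv_radius) order
  then have "(\<lambda>n. x * (of_nat n * a n * x ^ (n - Suc 0))) sums (x * (\<Sum>n. diffs a n * x ^ n))"
    by (intro sums_mult diffs_equiv)
  \<comment> \<open>At n = 0 the exponent \<open>n - Suc 0\<close> is truncated to 0, but the factor
    n makes both sides vanish.\<close>
  moreover have "x * (of_nat n * a n * x ^ (n - Suc 0)) = of_nat n * (a n * x ^ n)" for n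
    by (cases n) (auto simp: algebra_simps)
  ultimately show ?thesis
    by (simp only:)
qed

text \<open>Split n^2 = n(n - 1) + n: the second derivative yields the factorial moment, the first
  derivative the remaining n.\<close>

lemma powser_second_moment:
  fixes a :: "nat \<Rightarrow> 'a :: {banach, real_normed_field}"
  assumes "ereal (norm x) < conv_radius a"
  shows "(\<lambda>n. (of_nat n)\<^sup>2 * (a n * x ^ n)) sums
           (x\<^sup>2 * (\<Sum>n. diffs (diffs a) n * x ^ n) + x * (\<Sum>n. diffs a n * x ^ n))"
proof -
  have "ereal (norm x) < conv_radius (diffs a)"
    using assms conv_radius_diffs_ge[of a] by order
  then have "(\<lambda>n. x * (of_nat n * (diffs a n * x ^ n))) sums
      (x * (x * (\<Sum>n. diffs (diffs a) n * x ^ n)))"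
    by (intro sums_mult powser_first_moment)
  also have "(\<lambda>n. x * (of_nat n * (diffs a n * x ^ n))) =
      (\<lambda>n. of_nat (Suc n) * (of_nat (Suc n) - 1) * (a (Suc n) * x ^ Suc n))"
    by (auto simp: diffs_def algebra_simps)
  \<comment> \<open>The shift of the index by one is harmless, since the term at n = 0
    vanishes.\<close>
  finally have "(\<lambda>n. of_nat n * (of_nat n - 1) * (a n * x ^ n)) sums
      (x\<^sup>2 * (\<Sum>n. diffs (diffs a) n * x ^ n))"
    by (subst (asm) sums_Suc_iff) (simp add: power2_eq_square mult.assoc)
  from sums_add[OF this powser_first_moment[OF assms]] show ?thesis
    by (simp add: power2_eq_square algebra_simps)
qed

lemma powser_pos:
  fixes a :: "nat \<Rightarrow> real"
  assumes "\<And>n. a n > 0" and "x \<ge> 0" and "ereal x < conv_radius a"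
  shows "(\<Sum>n. a n * x ^ n) > 0"
\<comment> \<open>The term of index 0 is \<open>a 0\<close>, which is positive even at
  \<open>x = 0\<close>.\<close>
proof (rule suminf_pos2[of _ 0])
  show "summable (\<lambda>n. a n * x ^ n)"
    using assms by (intro summable_in_conv_radius) simp
qed (use assms in \<open>auto intro!: mult_nonneg_nonneg mult_pos_pos less_imp_le[OF assms(1)]\<close>)

lemma diffs_pos:
  fixes a :: "nat \<Rightarrow> real"
  assumes "\<And>n. a n > 0"
  shows "diffs a n > 0"
  using assms by (simp add: diffs_def add_pos_nonneg)

text \<open>Positivity of \<open>a 0\<close> and \<open>a 1\<close> keeps both denominators nonzero
  at 0, so \<open>h\<close> agrees near 0 with a differentiable function. Its value at 0 is
  \<open>d\<close>, because f(0) = a_0, f'(0) = a_1 and f''(0) = 2 a_2.\<close>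

lemma powser_log_deriv_diff:
  fixes a :: "nat \<Rightarrow> real"
  assumes pos: "\<And>n. a n > 0" and R: "conv_radius a > 0"
  defines "f \<equiv> \<lambda>x. \<Sum>n. a n * x ^ n"
  defines "h \<equiv> \<lambda>x. deriv (deriv f) x / deriv f x - deriv f x / f x"
  defines "d \<equiv> 2 * a 2 / a 1 - a 1 / a 0"
  shows "(h \<longlongrightarrow> d) (at 0)" and "(\<lambda>x. h x - d) \<in> O[at 0](\<lambda>x. x)"
proof -
  \<comment> \<open>\<open>g\<close> is \<open>h\<close> with the derivatives written as termwise
    differentiated series; both agree inside the disc of convergence.\<close>
  define g where "g = (\<lambda>x. (\<Sum>n. diffs (diffs a) n * x ^ n) / (\<Sum>n. diffs a n * x ^ n)
    - (\<Sum>n. diffs a n * x ^ n) / (\<Sum>n. a n * x ^ n))"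
  have R': "ereal (norm (0::real)) < conv_radius a"
    using R by (simp add: zero_ereal_def)
  have R'': "ereal (norm (0::real)) < conv_radius (diffs a)"
    "ereal (norm (0::real)) < conv_radius (diffs (diffs a))"
    using R' conv_radius_diffs_ge[of a] conv_radius_diffs_ge[of "diffs a"] by order+
  have [simp]: "a 0 \<noteq> 0" "diffs a 0 \<noteq> 0"
    using pos[of 0] diffs_pos[of a 0, OF pos] by auto
  have "(\<lambda>x. \<Sum>n. b n * x ^ n) field_differentiable at 0"
    if "ereal (norm (0::real)) < conv_radius b" for b :: "nat \<Rightarrow> real"
    using has_field_derivative_powser[OF that] field_differentiable_def by blast
  then have "g field_differentiable at 0"
    unfolding g_def using R' R''
    by (intro field_differentiable_diff field_differentiable_divide) auto
  then obtain D where D: "(g has_field_derivative D) (at 0)"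
    by (auto simp: field_differentiable_def)
  have g0: "g 0 = d"
    by (simp add: g_def d_def diffs_def numeral_2_eq_2)
  have "\<forall>\<^sub>F x in nhds 0. x \<in> eball (0::real) (conv_radius a)"
    using R by (intro eventually_nhds_in_open open_eball) (auto simp: zero_ereal_def)
  then have "\<forall>\<^sub>F x in nhds 0. g x = h x"
    by eventually_elim (auto simp: g_def h_def f_def deriv_powser deriv_deriv_powser)
  then have ev: "\<forall>\<^sub>F x in at 0. g x = h x"
    by (simp add: eventually_nhds_conv_at)
  have "(g \<longlongrightarrow> d) (at 0)"
    using DERIV_isCont[OF D] g0 by (simp add: isCont_def)
  then show "(h \<longlongrightarrow> d) (at 0)"
    using tendsto_cong[OF ev] by simp
  \<comment> \<open>A convergent difference quotient is bounded near 0, which is the O(x)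
    estimate.\<close>
  have "((\<lambda>x. (g x - d) / x) \<longlongrightarrow> D) (at 0)"
    using D g0 by (simp add: has_field_derivative_iff)
  then have "(\<lambda>x. g x - d) \<in> O[at 0](\<lambda>x. x)"
    by (rule bigoI_tendsto) (simp add: eventually_at_filter)
  moreover have "\<forall>\<^sub>F x in at 0. g x - d = h x - d"
    using ev by eventually_elim simp
  ultimately show "(\<lambda>x. h x - d) \<in> O[at 0](\<lambda>x. x)"
    by (rule iffD1[OF landau_o.big.in_cong, rotated])
qed

subsection \<open>Moments of distributions on the natural numbers\<close>

lemma pmf_embed_pmf_sums:
  fixes f :: "nat \<Rightarrow> real"
  assumes "\<And>n. f n \<ge> 0" and "f sums 1"
  shows "pmf (embed_pmf f) n = f n"
proof (rule pmf_embed_pmf[OF assms(1)])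
  show "(\<integral>\<^sup>+ n. ennreal (f n) \<partial>count_space UNIV) = 1"
    using suminf_ennreal_eq[OF assms] by (simp add: nn_integral_count_space_nat)
qed

text \<open>For nonnegative \<open>f\<close> convergence of the series is absolute, so it gives
  integrability together with the value of the integral.\<close>

lemma has_bochner_integral_nat_pmf:
  fixes p :: "nat pmf" and f :: "nat \<Rightarrow> real"
  assumes "\<And>n. f n \<ge> 0" and "(\<lambda>n. f n * pmf p n) sums s"
  shows "has_bochner_integral (measure_pmf p) f s"
proof -
  have int: "integrable (count_space UNIV) (\<lambda>n. pmf p n * f n)"
    using assms by (simp add: integrable_count_space_nat_iff abs_mult sums_iff mult.commute)
  have "integrable (measure_pmf p) f"
    using int by (simp add: measure_pmf_eq_density integrable_density)
  moreover have "integral\<^sup>L (measure_pmf p) f = s"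
    using integral_count_space_nat[OF int] assms(2)
    by (simp add: measure_pmf_eq_density integral_density sums_iff mult.commute)
  ultimately show ?thesis
    by (simp add: has_bochner_integral_iff)
qed

lemma sub_poissonianI:
  assumes m: "(\<lambda>n. real n * pmf p n) sums m" and s: "(\<lambda>n. (real n)\<^sup>2 * pmf p n) sums s"
    and neg: "(s - m\<^sup>2 - m) / m < 0"
  shows "sub_poissonian p"
proof -
  have "has_bochner_integral (measure_pmf p) real m"
    using m by (intro has_bochner_integral_nat_pmf) auto
  moreover have "has_bochner_integral (measure_pmf p) (\<lambda>n. (real n)\<^sup>2) s"
    using s by (intro has_bochner_integral_nat_pmf) auto
  ultimately have "integrable (measure_pmf p) real" "measure_pmf.expectation p real = m"
      "integrable (measure_pmf p) (\<lambda>n. (real n)\<^sup>2)"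
      "measure_pmf.expectation p (\<lambda>n. (real n)\<^sup>2) = s"
    by (auto simp: has_bochner_integral_iff)
  \<comment> \<open>Variance is the second moment minus the squared mean; this identity requires
    both moments to be finite.\<close>
  then show ?thesis
    using neg measure_pmf.variance_eq[of p real] by (simp add: sub_poissonian_def mandel_pmf_def)
qed

text \<open>\<open>number_op\<close> is diagonal in the basis of kets, so both expectations are real
  series with weights |psi_n|^2.\<close>

lemma mandel_sums:
  assumes m: "(\<lambda>n. real n * (cmod (\<psi> n))\<^sup>2) sums m"
    and s: "(\<lambda>n. (real n)\<^sup>2 * (cmod (\<psi> n))\<^sup>2) sums s"
  shows "mandel \<psi> = complex_of_real ((s - m\<^sup>2 - m) / m)"
proof -
  have *: "cnj w * w = complex_of_real ((cmod w)\<^sup>2)" for w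
    by (metis complex_norm_square mult.commute)
  have "cnj (\<psi> n) * number_op \<psi> n = complex_of_real (real n * (cmod (\<psi> n))\<^sup>2)" for n
    using *[of "\<psi> n"] by (simp add: number_op_def algebra_simps)
  moreover have "cnj (\<psi> n) * (number_op \<circ> number_op) \<psi> n
      = complex_of_real ((real n)\<^sup>2 * (cmod (\<psi> n))\<^sup>2)" for n
    using *[of "\<psi> n"] by (simp add: number_op_def algebra_simps power2_eq_square)
  ultimately have "expect number_op \<psi> = complex_of_real m"
      "expect (number_op \<circ> number_op) \<psi> = complex_of_real s"
    using sums_unique[OF sums_of_real[OF m, where ?'a = complex]]
      sums_unique[OF sums_of_real[OF s, where ?'a = complex]]
    by (simp_all only: expect_def fock_inner_def)
  then show ?thesis
    by (simp add: mandel_def)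
qed

subsection \<open>Coherent states\<close>

text \<open>The squared amplitudes of the coherent state before normalization, with the power of x
  split off. Squaring turns n(n+1)/4 into n(n+1)/2 and removes the root, hence these are also the
  coefficients of \<N>.\<close>

definition coherent_coeff :: "real \<Rightarrow> real \<Rightarrow> real \<Rightarrow> nat \<Rightarrow> real" where
  "coherent_coeff q l lam n =
     q powr (real n * (real n + 1) / 2) / ((l\<^sup>2 * q powr lam) ^ n * q_fact q n)"

lemma normalization_powser:
  "normalization q l lam = (\<lambda>x. \<Sum>n. coherent_coeff q l lam n * x ^ n)"
  by (simp add: normalization_def coherent_coeff_def fun_eq_iff)

section \<open>Coefficients and radius of convergence\<close>

context
  fixes q l lam :: real
  assumes q: "q > 0" "q \<noteq> 1" and l: "l \<noteq> 0"
begin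

text \<open>Numerator and denominator are both positive for q < 1 and both negative for q >
  1.\<close>

lemma q_number_pos: "n > 0 \<Longrightarrow> q_number q n > 0"
  using q by (cases "q < 1") (auto simp: q_number_def power_less_one_iff one_less_power
    intro!: divide_pos_pos divide_neg_neg)

lemma q_fact_pos: "q_fact q n > 0"
  unfolding q_fact_def by (intro prod_pos) (auto intro: q_number_pos)

lemma scale_pos: "l\<^sup>2 * q powr lam > 0"
  using q l by simp

lemma coherent_coeff_pos: "coherent_coeff q l lam n > 0"
  unfolding coherent_coeff_def
  by (rule divide_pos_pos[OF _ mult_pos_pos[OF zero_less_power[OF scale_pos] q_fact_pos]])
    (use q in simp)

lemma coherent_coeff_0: "coherent_coeff q l lam 0 = 1"
  using q by (simp add: coherent_coeff_def q_fact_def)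

text \<open>The triangular number n(n+1)/2 grows by n + 1. This recursion serves the ratio test and
  the values of a_1 and a_2.\<close>

lemma coherent_coeff_Suc:
  "coherent_coeff q l lam (Suc n) =
     coherent_coeff q l lam n * (q ^ Suc n / (l\<^sup>2 * q powr lam * q_number q (Suc n)))"
proof -
  have "real (Suc n) * (real (Suc n) + 1) / 2 = real n * (real n + 1) / 2 + real (Suc n)"
    by (simp add: field_simps)
  then have "q powr (real (Suc n) * (real (Suc n) + 1) / 2) =
      q powr (real n * (real n + 1) / 2) * q ^ Suc n"
    using q by (simp only: powr_add powr_realpow)
  moreover have "q_fact q (Suc n) = q_fact q n * q_number q (Suc n)"
    by (simp add: q_fact_def)
  ultimately show ?thesis
    by (simp add: coherent_coeff_def mult_ac)
qed

text \<open>Ratio test: with c = l^2 q^lambda, a_n / a_(n+1) = c (q^(-n-1) - 1) / (1 - q). This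
  diverges for q < 1 and tends to c / (q - 1) for q > 1.\<close>

lemma conv_radius_coherent_coeff: "conv_radius (coherent_coeff q l lam) = radius q l lam"
proof (rule conv_radius_ratio_limit_ereal)
  let ?a = "coherent_coeff q l lam" and ?c = "l\<^sup>2 * q powr lam"
  show "\<forall>\<^sub>F n in sequentially. ?a n \<noteq> 0"
    using coherent_coeff_pos by (intro always_eventually) (metis less_irrefl)
  have ratio: "norm (?a n) / norm (?a (Suc n)) = ?c * (((1 / q) ^ Suc n - 1) / (1 - q))" for n
  proof -
    have "norm (?a n) / norm (?a (Suc n)) = ?a n / ?a (Suc n)"
      using coherent_coeff_pos[of n] coherent_coeff_pos[of "Suc n"] by simp
    also have "\<dots> = ?c * (q_number q (Suc n) / q ^ Suc n)"
    proof -
      have "x / (x * (u / (c * v))) = c * (v / u)" if "x \<noteq> 0" for x u c v :: real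
        using that by simp
      moreover have "?a n \<noteq> 0"
        using coherent_coeff_pos[of n] by simp
      ultimately show ?thesis
        unfolding coherent_coeff_Suc .
    qed
    also have "q_number q (Suc n) / q ^ Suc n = ((1 / q) ^ Suc n - 1) / (1 - q)"
    proof -
      have "(1 - y) / d / y = (1 / y - 1) / d" if "y \<noteq> 0" for y d :: real
        using that by (simp add: diff_divide_distrib)
      from this[of "q ^ Suc n"] show ?thesis
        using q unfolding q_number_def power_one_over by simp
    qed
    finally show ?thesis .
  qed
  show "(\<lambda>n. ereal (norm (?a n) / norm (?a (Suc n)))) \<longlonglongrightarrow> radius q l lam"
  proof (cases "q < 1")
    case True
    have "filterlim (\<lambda>n. (1 / q) ^ n) at_infinity sequentially"
      using True q by (intro filterlim_realpow_sequentially_gt1) auto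
    \<comment> \<open>The powers are positive, so divergence in norm is divergence to plus
      infinity.\<close>
    then have "filterlim (\<lambda>n. (1 / q) ^ n) at_top sequentially"
      using q by (auto dest!: filterlim_at_infinity_imp_norm_at_top simp: norm_power)
    then have "filterlim (\<lambda>n. (1 / q) ^ Suc n) at_top sequentially"
      by (rule filterlim_compose) (rule filterlim_Suc)
    then have "filterlim (\<lambda>n. - 1 + (1 / q) ^ Suc n) at_top sequentially"
      by (rule filterlim_tendsto_add_at_top[OF tendsto_const])
    moreover have "?c / (1 - q) > 0"
      using True scale_pos by (intro divide_pos_pos) auto
    ultimately have "filterlim (\<lambda>n. ?c / (1 - q) * (- 1 + (1 / q) ^ Suc n)) at_top sequentially"
      by (intro filterlim_tendsto_pos_mult_at_top[OF tendsto_const])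
    moreover have "?c / (1 - q) * (- 1 + y) = ?c * ((y - 1) / (1 - q))" for y
      by simp
    ultimately have "filterlim (\<lambda>n. ?c * (((1 / q) ^ Suc n - 1) / (1 - q))) at_top sequentially"
      by (simp only:)
    then show ?thesis
      using True by (simp only: ratio radius_def if_True tendsto_PInfty_eq_at_top)
  next
    case False
    then have "(\<lambda>n. (1 / q) ^ Suc n) \<longlonglongrightarrow> 0"
      using q by (intro LIMSEQ_Suc LIMSEQ_power_zero) auto
    then have "(\<lambda>n. ?c * (((1 / q) ^ Suc n - 1) / (1 - q))) \<longlonglongrightarrow> ?c * ((0 - 1) / (1 - q))"
      using q by (intro tendsto_mult tendsto_divide tendsto_diff tendsto_const) auto
    moreover have "c * ((0 - 1) / (1 - q)) = c / (q - 1)" for c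
      using q by (simp add: divide_simps) (simp add: algebra_simps)
    ultimately show ?thesis
      using False by (simp only: ratio radius_def if_False lim_ereal)
  qed
qed

lemma radius_pos: "radius q l lam > 0"
  using q scale_pos by (auto simp: radius_def)

lemma coherent_coeff_log_deriv_diff_0:
  "2 * coherent_coeff q l lam 2 / coherent_coeff q l lam 1
     - coherent_coeff q l lam 1 / coherent_coeff q l lam 0
   = - (q * (1 - q) / (l\<^sup>2 * q powr lam * (1 + q)))"
proof -
  let ?c = "l\<^sup>2 * q powr lam"
  have 1: "coherent_coeff q l lam 1 = q / ?c"
    using coherent_coeff_Suc[of 0] q by (simp add: coherent_coeff_0 q_number_def)
  have "q_number q 2 = 1 + q"
    using q by (simp add: q_number_def field_simps power2_eq_square)
  then have 2: "coherent_coeff q l lam 2 =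
      coherent_coeff q l lam 1 * (q\<^sup>2 / (l\<^sup>2 * q powr lam * (1 + q)))"
    using coherent_coeff_Suc[of 1] by (simp add: numeral_2_eq_2)
  have "2 * coherent_coeff q l lam 2 / coherent_coeff q l lam 1 = 2 * (q\<^sup>2 / (?c * (1 + q)))"
    using coherent_coeff_pos[of 1] unfolding 2 by simp
  \<comment> \<open>With a_0 = 1, a_1 = q/c and a_2/a_1 = q^2 / (c(1+q)), the numerator over c(1+q)
    is 2q^2 - q(1+q) = -q(1-q).\<close>
  moreover have "2 * (q\<^sup>2 / (c * (1 + q))) - q / c / 1 = - (q * (1 - q) / (c * (1 + q)))"
    if "c > 0" for c
    using that q by (simp add: divide_simps) (simp add: algebra_simps power2_eq_square)
  ultimately show ?thesis
    using scale_pos by (simp only: 1 coherent_coeff_0)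
qed

section \<open>A fixed coherent state\<close>

context
  fixes z :: complex
  assumes z: "z \<in> coherent_domain q l lam"
begin

lemma norm_less_conv_radius:
  "ereal (norm ((cmod z)\<^sup>2)) < conv_radius (coherent_coeff q l lam)"
  using z by (simp add: coherent_domain_def conv_radius_coherent_coeff)

lemma normalization_pos: "normalization q l lam ((cmod z)\<^sup>2) > 0"
  unfolding normalization_powser using norm_less_conv_radius coherent_coeff_pos
  by (intro powser_pos) auto

lemma deriv_normalization_pos: "deriv (normalization q l lam) ((cmod z)\<^sup>2) > 0"
proof -
  have "ereal ((cmod z)\<^sup>2) < conv_radius (diffs (coherent_coeff q l lam))"
    using norm_less_conv_radius conv_radius_diffs_ge[of "coherent_coeff q l lam"] by simp
  then show ?thesis
    unfolding normalization_powser deriv_powser[OF norm_less_conv_radius]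
    by (intro powser_pos diffs_pos coherent_coeff_pos) auto
qed

lemma norm_coherent_state_square:
  "(cmod (coherent_state q l lam z n))\<^sup>2 =
     coherent_coeff q l lam n * ((cmod z)\<^sup>2) ^ n / normalization q l lam ((cmod z)\<^sup>2)"
proof -
  let ?N = "normalization q l lam ((cmod z)\<^sup>2)"
  have "(?N powr (- 1 / 2))\<^sup>2 = ?N powr (- 1)"
    by (simp add: power2_eq_square flip: powr_add)
  also have "\<dots> = 1 / ?N"
    using normalization_pos by (simp add: powr_minus_divide)
  finally have N: "(?N powr (- 1 / 2))\<^sup>2 = 1 / ?N" .
  have Q: "(q powr (real n * (real n + 1) / 4))\<^sup>2 = q powr (real n * (real n + 1) / 2)"
    by (simp add: power2_eq_square flip: powr_add)
  define d where "d = (l\<^sup>2 * q powr lam) ^ n * q_fact q n"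
  \<comment> \<open>The sign matters: for negative \<open>d\<close>, \<open>(sqrt d)\<^sup>2\<close>
    would be \<open>-d\<close>.\<close>
  have "d > 0"
    unfolding d_def by (rule mult_pos_pos[OF zero_less_power[OF scale_pos] q_fact_pos])
  then have S: "(sqrt d)\<^sup>2 = d"
    by simp
  have Z: "((cmod z) ^ n)\<^sup>2 = ((cmod z)\<^sup>2) ^ n"
    by (metis mult.commute power_mult)
  show ?thesis
    unfolding coherent_state_def coherent_coeff_def d_def[symmetric]
    unfolding norm_mult norm_divide norm_of_real norm_power power_mult_distrib power_divide power2_abs N Q S Z by simp
qed

text \<open>All three series carry the weights a_n x^n / \<N>(x). The first says that the state is a
  unit vector, which gives \<open>quanta_pmf\<close> its intended values.\<close>

lemma coherent_state_moments:
  defines "x \<equiv> (cmod z)\<^sup>2" and "\<N> \<equiv> normalization q l lam"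
  shows "(\<lambda>n. (cmod (coherent_state q l lam z n))\<^sup>2) sums 1"
    and "(\<lambda>n. real n * (cmod (coherent_state q l lam z n))\<^sup>2) sums (x * deriv \<N> x / \<N> x)"
    and "(\<lambda>n. (real n)\<^sup>2 * (cmod (coherent_state q l lam z n))\<^sup>2) sums
           ((x\<^sup>2 * deriv (deriv \<N>) x + x * deriv \<N> x) / \<N> x)"
proof -
  note R = norm_less_conv_radius[folded x_def]
  have D: "deriv \<N> x = (\<Sum>n. diffs (coherent_coeff q l lam) n * x ^ n)"
      "deriv (deriv \<N>) x = (\<Sum>n. diffs (diffs (coherent_coeff q l lam)) n * x ^ n)"
    unfolding \<N>_def normalization_powser by (intro deriv_powser deriv_deriv_powser R)+
  have "(\<lambda>n. coherent_coeff q l lam n * x ^ n) sums \<N> x"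
    unfolding \<N>_def normalization_powser by (intro summable_sums summable_in_conv_radius R)
  from sums_divide[OF this, of "\<N> x"]
  show "(\<lambda>n. (cmod (coherent_state q l lam z n))\<^sup>2) sums 1"
    using normalization_pos by (simp add: norm_coherent_state_square x_def \<N>_def)
  show "(\<lambda>n. real n * (cmod (coherent_state q l lam z n))\<^sup>2) sums (x * deriv \<N> x / \<N> x)"
    using sums_divide[OF powser_first_moment[OF R], of "\<N> x", folded D]
    by (simp add: norm_coherent_state_square x_def \<N>_def)
  show "(\<lambda>n. (real n)\<^sup>2 * (cmod (coherent_state q l lam z n))\<^sup>2) sums
           ((x\<^sup>2 * deriv (deriv \<N>) x + x * deriv \<N> x) / \<N> x)"
    using sums_divide[OF powser_second_moment[OF R], of "\<N> x", folded D]
    by (simp add: norm_coherent_state_square x_def \<N>_def)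
qed

text \<open>Here s - m = x^2 \<N>''/\<N>, and division by m = x \<N>'/\<N> leaves x \<N>''/\<N>' -
  m. The assumption on \<open>z\<close> ensures that m is nonzero.\<close>

lemma mandel_moments_eq:
  assumes "z \<noteq> 0"
  defines "x \<equiv> (cmod z)\<^sup>2" and "\<N> \<equiv> normalization q l lam"
  defines "m \<equiv> x * deriv \<N> x / \<N> x"
    and "s \<equiv> (x\<^sup>2 * deriv (deriv \<N>) x + x * deriv \<N> x) / \<N> x"
  shows "(s - m\<^sup>2 - m) / m = x * (deriv (deriv \<N>) x / deriv \<N> x - deriv \<N> x / \<N> x)"
proof -
  have "x \<noteq> 0" "\<N> x \<noteq> 0" "deriv \<N> x \<noteq> 0"
    using assms(1) normalization_pos deriv_normalization_pos by (auto simp: x_def \<N>_def)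
  then show ?thesis
    by (simp add: m_def s_def field_simps power2_eq_square)
qed

lemma mandel_coherent_state:
  assumes "z \<noteq> 0"
  defines "x \<equiv> (cmod z)\<^sup>2" and "\<N> \<equiv> normalization q l lam"
  shows "mandel (coherent_state q l lam z) =
    complex_of_real (x * (deriv (deriv \<N>) x / deriv \<N> x - deriv \<N> x / \<N> x))"
  using mandel_sums[OF coherent_state_moments(2,3)] mandel_moments_eq[OF assms(1)]
  by (simp only: x_def \<N>_def)

lemma pmf_quanta_coherent_state:
  "pmf (quanta_pmf (coherent_state q l lam z)) n = (cmod (coherent_state q l lam z n))\<^sup>2"
  unfolding quanta_pmf_def fock_inner_ket using coherent_state_moments(1)
  by (intro pmf_embed_pmf_sums) auto

lemma sub_poissonian_coherent_state:
  assumes "z \<noteq> 0"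
  defines "x \<equiv> (cmod z)\<^sup>2" and "\<N> \<equiv> normalization q l lam"
  assumes "deriv (deriv \<N>) x / deriv \<N> x - deriv \<N> x / \<N> x < 0"
  shows "sub_poissonian (quanta_pmf (coherent_state q l lam z))"
proof (rule sub_poissonianI)
  have "x > 0"
    using assms(1) by (simp add: x_def)
  then have "x * (deriv (deriv \<N>) x / deriv \<N> x - deriv \<N> x / \<N> x) < 0"
    using assms(4) by (rule mult_pos_neg)
  then show "((x\<^sup>2 * deriv (deriv \<N>) x + x * deriv \<N> x) / \<N> x - (x * deriv \<N> x / \<N> x)\<^sup>2
      - x * deriv \<N> x / \<N> x) / (x * deriv \<N> x / \<N> x) < 0"
    unfolding x_def \<N>_def mandel_moments_eq[OF assms(1)] .
qed (use coherent_state_moments(2,3) in \<open>simp_all only: pmf_quanta_coherent_state x_def \<N>_def\<close>)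

end

section \<open>Behaviour as z tends to 0\<close>

lemma filterlim_cmod_square_at_0: "filterlim (\<lambda>z. (cmod z)\<^sup>2) (at 0) (at 0)"
\<comment> \<open>Besides the limit, the squared modulus must avoid 0 for nonzero z; then punctured
  limits in x pull back to z.\<close>
proof (rule filterlim_atI)
  show "((\<lambda>z. (cmod z)\<^sup>2) \<longlongrightarrow> 0) (at 0)"
    by (rule tendsto_eq_intros tendsto_norm_zero tendsto_ident_at refl | simp)+
qed (simp add: eventually_at_filter)

text \<open>The radius is positive, so small z lie in the domain; \<open>at 0\<close> excludes z = 0
  itself.\<close>

lemma eventually_coherent_domain: "\<forall>\<^sub>F z in at 0. z \<in> coherent_domain q l lam \<and> z \<noteq> 0"
proof -
  have "((\<lambda>z. (cmod z)\<^sup>2) \<longlongrightarrow> 0) (at 0)"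
    using filterlim_cmod_square_at_0 by (simp add: filterlim_at)
  then have "((\<lambda>z. ereal ((cmod z)\<^sup>2)) \<longlongrightarrow> 0) (at 0)"
    by (simp add: zero_ereal_def)
  then have "\<forall>\<^sub>F z in at 0. ereal ((cmod z)\<^sup>2) < radius q l lam"
    by (rule order_tendstoD) (rule radius_pos)
  then show ?thesis
    by (auto simp: coherent_domain_def eventually_at_filter elim!: eventually_mono)
qed

text \<open>Since Q = x h(x), multiplying h(x) - h(0) = O(x) by x gives the remainder
  O(x^2).\<close>

lemma mandel_coherent_state_bigo:
  "(\<lambda>z. mandel (coherent_state q l lam z) -
      complex_of_real (- (q * (1 - q) / (l\<^sup>2 * q powr lam * (1 + q))) * (cmod z)\<^sup>2))
    \<in> O[at 0](\<lambda>z. complex_of_real (((cmod z)\<^sup>2)\<^sup>2))"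
proof -
  let ?N = "normalization q l lam" and ?d = "- (q * (1 - q) / (l\<^sup>2 * q powr lam * (1 + q)))"
  let ?h = "\<lambda>x. deriv (deriv ?N) x / deriv ?N x - deriv ?N x / ?N x"
  have "(\<lambda>x. ?h x - ?d) \<in> O[at 0](\<lambda>x. x)"
    using powser_log_deriv_diff(2)[of "coherent_coeff q l lam", OF coherent_coeff_pos] radius_pos
    by (simp only: conv_radius_coherent_coeff normalization_powser coherent_coeff_log_deriv_diff_0)
  then have "(\<lambda>z. ?h ((cmod z)\<^sup>2) - ?d) \<in> O[at 0](\<lambda>z. (cmod z)\<^sup>2)"
    by (rule landau_o.big.compose[OF _ filterlim_cmod_square_at_0])
  then have "(\<lambda>z. (cmod z)\<^sup>2 * (?h ((cmod z)\<^sup>2) - ?d)) \<in> O[at 0](\<lambda>z. (cmod z)\<^sup>2 * (cmod z)\<^sup>2)"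
    by (intro landau_o.big.mult landau_o.big_refl)
  then have *: "(\<lambda>z. complex_of_real ((cmod z)\<^sup>2 * (?h ((cmod z)\<^sup>2) - ?d)))
      \<in> O[at 0](\<lambda>z. complex_of_real (((cmod z)\<^sup>2)\<^sup>2))"
    by (simp only: landau_o.big.of_real_iff power2_eq_square[of "(cmod _)\<^sup>2"])
  \<comment> \<open>The closed form of Q holds for nonzero z in the domain, hence eventually at
    0.\<close>
  have "\<forall>\<^sub>F z in at 0. complex_of_real ((cmod z)\<^sup>2 * (?h ((cmod z)\<^sup>2) - ?d)) =
      mandel (coherent_state q l lam z) - complex_of_real (?d * (cmod z)\<^sup>2)"
    using eventually_coherent_domain
  proof eventually_elim
    case (elim z)
    then have "mandel (coherent_state q l lam z) =
        complex_of_real ((cmod z)\<^sup>2 * ?h ((cmod z)\<^sup>2))"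
      by (intro mandel_coherent_state) auto
    then show ?case
      by (simp only: right_diff_distrib of_real_diff mult.commute)
  qed
  with * show ?thesis
    by (rule iffD1[OF landau_o.big.in_cong, rotated])
qed

text \<open>As x > 0, Q has the sign of h(x), which near 0 is that of its limit; this limit has the
  sign of q - 1.\<close>

lemma eventually_sub_poissonian:
  assumes "q < 1"
  shows "\<forall>\<^sub>F z in at 0. sub_poissonian (quanta_pmf (coherent_state q l lam z))"
proof -
  let ?N = "normalization q l lam" and ?d = "- (q * (1 - q) / (l\<^sup>2 * q powr lam * (1 + q)))"
  let ?h = "\<lambda>x. deriv (deriv ?N) x / deriv ?N x - deriv ?N x / ?N x"
  have "(?h \<longlongrightarrow> ?d) (at 0)"
    using powser_log_deriv_diff(1)[of "coherent_coeff q l lam", OF coherent_coeff_pos] radius_pos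
    by (simp only: conv_radius_coherent_coeff normalization_powser coherent_coeff_log_deriv_diff_0)
  then have lim: "((\<lambda>z. ?h ((cmod z)\<^sup>2)) \<longlongrightarrow> ?d) (at 0)"
    by (rule filterlim_compose[OF _ filterlim_cmod_square_at_0])
  have "?d < 0"
    using assms q scale_pos by simp
  then have "\<forall>\<^sub>F z in at 0. ?h ((cmod z)\<^sup>2) < 0"
    by (rule order_tendstoD(2)[OF lim])
  then show ?thesis
    using eventually_coherent_domain
    by eventually_elim (auto intro: sub_poissonian_coherent_state)
qed

end

text \<open>Smallness of x is expressed by the punctured filter \<open>at 0\<close> for z. The last
  claim is confined to q < 1: for q > 1 the leading coefficient is positive, so Q > 0 for small
  nonzero z.\<close>

theorem mainTheorem8:
  fixes q l lam :: real
  assumes "q > 0" and "q \<noteq> 1" and "l \<noteq> 0"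
  shows "(\<forall>z \<in> coherent_domain q l lam. z \<noteq> 0 \<longrightarrow>
            (let x = (cmod z)\<^sup>2; \<N> = normalization q l lam in
               mandel (coherent_state q l lam z) =
                 complex_of_real (x * (deriv (deriv \<N>) x / deriv \<N> x - deriv \<N> x / \<N> x))))
       \<and> (\<lambda>z. mandel (coherent_state q l lam z) -
              complex_of_real (- (q * (1 - q) / (l\<^sup>2 * q powr lam * (1 + q))) * (cmod z)\<^sup>2))
            \<in> O[at 0](\<lambda>z. complex_of_real (((cmod z)\<^sup>2)\<^sup>2))
       \<and> (\<forall>z \<in> coherent_domain q l lam. z \<noteq> 0 \<longrightarrow> (\<forall>n.
            pmf (quanta_pmf (coherent_state q l lam z)) n
              = (cmod (fock_inner (ket n) (coherent_state q l lam z)))\<^sup>2 \<and>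
            (cmod (fock_inner (ket n) (coherent_state q l lam z)))\<^sup>2
              = q powr (real n * (real n + 1) / 2) * ((cmod z)\<^sup>2) ^ n
                / ((l\<^sup>2 * q powr lam) ^ n * q_fact q n * normalization q l lam ((cmod z)\<^sup>2))))
       \<and> (q < 1 \<longrightarrow> (\<forall>\<^sub>F z in at 0. sub_poissonian (quanta_pmf (coherent_state q l lam z))))"
proof (intro conjI ballI allI impI)
  fix z assume "z \<in> coherent_domain q l lam" "z \<noteq> 0"
  then show "let x = (cmod z)\<^sup>2; \<N> = normalization q l lam in
               mandel (coherent_state q l lam z) =
                 complex_of_real (x * (deriv (deriv \<N>) x / deriv \<N> x - deriv \<N> x / \<N> x))"
    unfolding Let_def by (rule mandel_coherent_state[OF assms])
next
  fix z n assume z: "z \<in> coherent_domain q l lam"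
  show "pmf (quanta_pmf (coherent_state q l lam z)) n
      = (cmod (fock_inner (ket n) (coherent_state q l lam z)))\<^sup>2"
    unfolding fock_inner_ket by (rule pmf_quanta_coherent_state[OF assms z])
  show "(cmod (fock_inner (ket n) (coherent_state q l lam z)))\<^sup>2
      = q powr (real n * (real n + 1) / 2) * ((cmod z)\<^sup>2) ^ n
        / ((l\<^sup>2 * q powr lam) ^ n * q_fact q n * normalization q l lam ((cmod z)\<^sup>2))"
    unfolding fock_inner_ket norm_coherent_state_square[OF assms z] coherent_coeff_def by simp
qed (rule mandel_coherent_state_bigo[OF assms] eventually_sub_poissonian[OF assms], assumption?)+

end
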